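(* Let $A$ be a monomial algebra over a field $K$ which is amenable as a right module over itself. Then $A$ has monomial $(V,\varepsilon)$-invariant subspaces: for every finite-dimensional subspace $V\leq A$ and every $\varepsilon>0$ there is a $(V,\varepsilon)$-invariant subspace of $A$ spanned by monomials. Furthermore, if $A$ is exhaustively amenable as a right module over itself, then it has a monomial Følner sequence, that is, a Følner sequence (as a right module over itself) consisting of subspaces spanned by monomials.
   Context: Algebras are associative and unital. A monomial algebra is a finitely generated algebra $A=K\langle x_1,\dots,x_d\rangle/I$ where $I$ is an ideal of the free algebra generated by monomials $x_{i_1}\cdots x_{i_r}$; monomials of $A$ are the images of words in $x_1,\dots,x_d$ (including the empty word $1$). For a right $A$-module $M$, a finite-dimensional subspace $V\leq A$ and $\varepsilon>0$, a finite-dimensional subspace $L\leq M$ is $(V,\varepsilon)$-invariant if $\dim_K LV<(1+\varepsilon)\dim_K L$, where $LV$ is the span of all products $\ell v$, $\ell\in L$, $v\in V$. $M$ is amenable if for every finite-dimensional $V\leq A$ and every $\varepsilon>0$ it has a $(V,\varepsilon)$-invariant subspace. $M$ is exhaustively amenable if for every finite-dimensional $V\leq A$, every $\varepsilon>0$ and every finite-dimensional $W\leq M$ there is a $(V,\varepsilon)$-invariant subspace of $M$ containing $W$. For a finitely generated algebra $A=K\langle V\rangle$, with $V$ any finite-dimensional generating subspace, a Følner sequence of $A$ (as a right module over itself, with respect to $V$) is a chain of finite-dimensional $K$-subspaces $L_1\subseteq L_2\subseteq\cdots$ of $A$ such that $A=\bigcup_{n=1}^{\infty}L_n$ and $\dim_K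 L_nV/\dim_K L_n\to1$ as $n\to\infty$.
   Formalization: The Følner sequence is claimed for a generating subspace V only if 1 ∈ V or A is infinite-dimensional; otherwise it can fail: for A = K[x]/(x²) and V = Kx, every exhausting chain is eventually A and dim AV/dim A = 1/2. *)

theory Defs
  imports Complex_Main "HOL-Library.Poly_Mapping"
begin

section \<open>Algebras, right modules and amenability\<close>

locale algebra_over = vector_space scale
  for scale :: "'k::field \<Rightarrow> 'a::ring_1 \<Rightarrow> 'a" +
  assumes scale_mult_left: "scale c a * b = scale c (a * b)"
    and scale_mult_right: "a * scale c b = scale c (a * b)"

context vector_space
begin

definition fd_subspace :: "'b set \<Rightarrow> bool" where
  "fd_subspace L \<longleftrightarrow> (\<exists>B. finite B \<and> L = span B)"

end

text \<open>Note that \<open>dim\<close> is \<open>0\<close> on infinite-dimensional spaces; it is only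
  ever applied to finite-dimensional ones below.\<close>

locale right_module = A: algebra_over sA + M: vector_space sM
  for sA :: "'k::field \<Rightarrow> 'a::ring_1 \<Rightarrow> 'a"
    and sM :: "'k \<Rightarrow> 'm::ab_group_add \<Rightarrow> 'm" +
  fixes act :: "'m \<Rightarrow> 'a \<Rightarrow> 'm"
  assumes act_add_left: "act (m + n) a = act m a + act n a"
    and act_add_right: "act m (a + b) = act m a + act m b"
    and act_scale_left: "act (sM c m) a = sM c (act m a)"
    and act_scale_right: "act m (sA c a) = sM c (act m a)"
    and act_mult: "act m (a * b) = act (act m a) b"
    and act_one: "act m 1 = m"
begin

definition prod_space :: "'m set \<Rightarrow> 'a set \<Rightarrow> 'm set" where
  "prod_space L V = M.span {act l v | l v. l \<in> L \<and> v \<in> V}"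

text \<open>The strict inequality forces an invariant subspace to be nonzero.\<close>

definition invariant_subspace :: "'a set \<Rightarrow> real \<Rightarrow> 'm set \<Rightarrow> bool" where
  "invariant_subspace V \<epsilon> L \<longleftrightarrow>
     M.fd_subspace L \<and> real (M.dim (prod_space L V)) < (1 + \<epsilon>) * real (M.dim L)"

definition amenable :: bool where
  "amenable \<longleftrightarrow> (\<forall>V \<epsilon>. A.fd_subspace V \<longrightarrow> \<epsilon> > 0 \<longrightarrow> (\<exists>L. invariant_subspace V \<epsilon> L))"

definition exhaustively_amenable :: bool where
  "exhaustively_amenable \<longleftrightarrow>
     (\<forall>V \<epsilon> W. A.fd_subspace V \<longrightarrow> \<epsilon> > 0 \<longrightarrow> M.fd_subspace W \<longrightarrow>
        (\<exists>L. invariant_subspace V \<epsilon> L \<and> W \<subseteq> L))"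

end

context algebra_over
begin

sublocale regular: right_module scale scale "(*)"
  by unfold_locales (simp_all add: algebra_simps scale_mult_left scale_mult_right)

definition subalgebra :: "'a set \<Rightarrow> bool" where
  "subalgebra S \<longleftrightarrow> subspace S \<and> 1 \<in> S \<and> (\<forall>a\<in>S. \<forall>b\<in>S. a * b \<in> S)"

definition generating_subspace :: "'a set \<Rightarrow> bool" where
  "generating_subspace V \<longleftrightarrow> fd_subspace V \<and> subalgebra hull V = UNIV"

text \<open>Since the generating subspace need not contain \<open>1\<close>, a finite-dimensional algebra
  may have no Folner sequence with respect to it: an exhausting chain in \<open>A = K[x]/(x\<^sup>2)\<close>
  is eventually constantly \<open>A\<close>, and for \<open>V = K x\<close> the product \<open>A V = K x\<close>
  has dimension ratio \<open>1/2\<close>, although this \<open>A\<close> is a monomial algebra and is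
  exhaustively amenable over itself. Existence results therefore have to assume \<open>1 \<in> V\<close>
  when the algebra is finite-dimensional.\<close>

definition Folner_sequence :: "'a set \<Rightarrow> (nat \<Rightarrow> 'a set) \<Rightarrow> bool" where
  "Folner_sequence V L \<longleftrightarrow>
     (\<forall>n. fd_subspace (L n)) \<and> (\<forall>n. L n \<subseteq> L (Suc n)) \<and> (\<Union>n. L n) = UNIV \<and>
     (\<lambda>n. real (dim (regular.prod_space (L n) V)) / real (dim (L n))) \<longlonglongrightarrow> 1"

end

section \<open>The free algebra and monomial algebras\<close>

text \<open>Words over an alphabet form a monoid under concatenation, written additively so
  that \<open>'x free_word \<Rightarrow>\<^sub>0 'k\<close> carries the convolution product: this is the
  free algebra over \<open>'k\<close> on the letters \<open>'x\<close>.\<close>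

datatype 'x free_word = Word (letters: "'x list")

instantiation free_word :: (type) monoid_add
begin

definition "0 = Word []"
definition "u + v = Word (letters u @ letters v)"

instance
  by standard (simp_all add: zero_free_word_def plus_free_word_def)

end

definition word_monom :: "'x free_word \<Rightarrow> ('x free_word \<Rightarrow>\<^sub>0 'k::field)" where
  "word_monom w = Poly_Mapping.single w 1"

definition two_sided_ideal :: "'a::ring_1 set \<Rightarrow> bool" where
  "two_sided_ideal I \<longleftrightarrow> 0 \<in> I \<and> (\<forall>a\<in>I. \<forall>b\<in>I. a + b \<in> I) \<and>
     (\<forall>a\<in>I. \<forall>r. r * a \<in> I \<and> a * r \<in> I)"

text \<open>A monomial algebra is presented by its quotient map: a surjective algebra homomorphism
  \<open>\<pi>\<close> from the free algebra on a finite alphabet whose kernel is generated, as a two-sided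
  ideal, by a (possibly infinite) set of words. In the free algebra the scalar \<open>c\<close> is
  \<open>Poly_Mapping.single 0 c\<close>. The class \<open>ring_1\<close> excludes only the zero algebra,
  which is not amenable.\<close>

locale monomial_algebra = algebra_over scale
  for scale :: "'k::field \<Rightarrow> 'a::ring_1 \<Rightarrow> 'a" +
  fixes \<pi> :: "('x::finite free_word \<Rightarrow>\<^sub>0 'k) \<Rightarrow> 'a"
  assumes \<pi>_add: "\<pi> (f + g) = \<pi> f + \<pi> g"
    and \<pi>_mult: "\<pi> (f * g) = \<pi> f * \<pi> g"
    and \<pi>_one: "\<pi> 1 = 1"
    and \<pi>_scale: "\<pi> (Poly_Mapping.single 0 c * f) = scale c (\<pi> f)"
    and \<pi>_surj: "surj \<pi>"
    and \<pi>_kernel: "\<exists>R. {f. \<pi> f = 0} = two_sided_ideal hull (word_monom ` R)"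
begin

definition monomials :: "'a set" where
  "monomials = range (\<lambda>w. \<pi> (word_monom w))"

definition spanned_by_monomials :: "'a set \<Rightarrow> bool" where
  "spanned_by_monomials L \<longleftrightarrow> (\<exists>T \<subseteq> monomials. L = span T)"

end

end

theory Submission
  imports Defs "HOL-Library.List_Lexorder" "HOL-Library.Countable"
begin

text \<open>
  Leading terms turn an arbitrary subspace into a monomial one. The nonzero monomials form a basis
  of \<open>A\<close>. Order the words so that appending the same word on the right preserves strict
  inequalities, and replace a finite-dimensional \<open>L \<le> A\<close> by the span \<open>L'\<close> of its leading monomials,
  which has the same dimension (\<open>card_lead_eq_dim\<close>). If \<open>V\<close> is spanned by monomials, then the
  leading monomial of \<open>a \<in> L\<close> times a monomial \<open>v \<in> V\<close> is zero or is the leading monomial of \<open>a v\<close>, so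
  \<open>L' V\<close> lies in the span of the leading monomials of \<open>L V\<close> (\<open>prod_space_lead_subset\<close>). Thus
  \<open>dim L' V \<le> dim L V\<close>: invariance of \<open>L\<close> passes to \<open>L'\<close>. An arbitrary \<open>V\<close> sits inside a
  finite-dimensional space spanned by monomials. Moreover, monomials contained in \<open>L\<close> are also in
  \<open>L'\<close>, so exhaustive amenability gives monomial invariant subspaces that contain any given finite
  set of monomials.

  For a Folner sequence the ratio \<open>dim L V / dim L\<close> must tend to 1, while invariance only bounds it
  from above; if \<open>1 \<notin> V\<close>, it may be far below 1. In an infinite-dimensional \<open>A\<close> this can be
  repaired by enlarging \<open>L\<close> one monomial at a time. Since \<open>V\<close> generates, \<open>A = K 1 + A V\<close>, so \<open>A V\<close> is
  infinite-dimensional and there is always a monomial whose addition to \<open>L\<close> makes \<open>L V\<close> grow. Every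
  such addition raises \<open>dim L\<close> by one and \<open>dim L V\<close> by at least one and at most \<open>dim V\<close>. Hence the
  ratio eventually exceeds \<open>1 - \<epsilon>\<close>, and at the first such moment it is still at most \<open>1 + \<epsilon>\<close> if
  \<open>dim L\<close> was large compared with \<open>dim V\<close> at the start (\<open>nearly_balanced_superset\<close>). In the remaining case
  \<open>A\<close> is finite-dimensional and \<open>1 \<in> V\<close>, so \<open>A V = A\<close> and the constant sequence \<open>A\<close> works.
\<close>

section \<open>Finite-dimensional subspaces\<close>

context vector_space
begin

lemma fd_subspace_spanI: "finite B \<Longrightarrow> fd_subspace (span B)"
  by (auto simp: fd_subspace_def)

lemma fd_subspace_basis:
  assumes "fd_subspace L"
  obtains B where "finite B" "independent B" "span B = L" "card B = dim L"
proof -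
  obtain C where C: "finite C" "L = span C"
    using assms by (auto simp: fd_subspace_def)
  obtain B where B: "B \<subseteq> C" "independent B" "C \<subseteq> span B"
    using maximal_independent_subset[of C] by metis
  have "span B = L"
    using B C by (metis span_eq span_superset subset_trans)
  then show thesis
    using that[of B] B C(1) dim_span_eq_card_independent[of B] by (auto intro: finite_subset)
qed

lemma card_independent_le_dim_fd:
  assumes "fd_subspace L" "independent T" "T \<subseteq> L"
  shows "finite T \<and> card T \<le> dim L"
proof -
  obtain B where B: "finite B" "span B = L" "card B = dim L"
    using fd_subspace_basis[OF assms(1)] by metis
  show ?thesis
    using independent_span_bound[of B T] assms B by auto
qed

lemma dim_mono_fd:
  assumes "fd_subspace M" "L \<subseteq> M"
  shows "dim L \<le> dim M"
  using assms by (metis dim_le_card fd_subspace_basis order_refl)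

lemma dim_strict_mono_fd:
  assumes "fd_subspace M" "fd_subspace L" "L \<subseteq> M" "x \<in> M" "x \<notin> L"
  shows "dim L < dim M"
proof -
  obtain B where B: "finite B" "independent B" "span B = L" "card B = dim L"
    using fd_subspace_basis[OF assms(2)] by metis
  have "x \<notin> B"
    using B(3) assms(5) span_superset by blast
  moreover have "independent (insert x B)"
    using independent_insertI B assms(5) by blast
  moreover have "insert x B \<subseteq> M"
    using B(3) assms(3,4) span_superset by blast
  ultimately show ?thesis
    using card_independent_le_dim_fd[OF assms(1), of "insert x B"] B by simp
qed

end

section \<open>Leading indices\<close>

locale ordered_independent_family = vector_space scale
  for scale :: "'k::field \<Rightarrow> 'b::ab_group_add \<Rightarrow> 'b" (infixr "*s" 75) +
  fixes e :: "'i::linorder \<Rightarrow> 'b" and I :: "'i set"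
  assumes indep: "independent (e ` I)" and inj: "inj_on e I"
begin

text \<open>For a subspace \<open>L\<close> of the span of the family, these are the largest indices in the supports of
  the nonzero vectors of \<open>L\<close>; the witness \<open>a\<close> is scaled to leading coefficient 1. Saying this with
  spans of lower basis vectors, not with coordinates, makes it easy to follow under
  multiplication.\<close>

definition lead :: "'b set \<Rightarrow> 'i set" where
  "lead L = {i\<in>I. \<exists>a\<in>L. a - e i \<in> span (e ` {j\<in>I. j < i})}"

lemma lead_mono: "L \<subseteq> M \<Longrightarrow> lead L \<subseteq> lead M"
  by (auto simp: lead_def)

lemma lead_subset: "lead L \<subseteq> I"
  by (auto simp: lead_def)

lemma mem_leadI: "i \<in> I \<Longrightarrow> e i \<in> L \<Longrightarrow> i \<in> lead L"
  by (auto simp: lead_def span_zero intro!: bexI[of _ "e i"])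

text \<open>Vectors of \<open>L\<close> with distinct leading indices are linearly independent: each one has a leading
  term that does not occur in those with smaller leading index.\<close>

lemma card_lead_le_dim:
  assumes L: "fd_subspace L"
  shows "finite (lead L) \<and> card (lead L) \<le> dim L"
proof -
  define low where "low i = span (e ` {j\<in>I. j < i})" for i
  have "\<forall>i\<in>lead L. \<exists>a. a \<in> L \<and> a - e i \<in> low i"
    by (auto simp: lead_def low_def)
  then obtain a where a: "\<And>i. i \<in> lead L \<Longrightarrow> a i \<in> L \<and> a i - e i \<in> low i"
    by (metis bchoice)
  have indep_a: "independent (a ` T) \<and> card (a ` T) = card T"
    if "finite T" "T \<subseteq> lead L" for T
    using that
  proof (induction T rule: finite_linorder_max_induct)
    case (insert m T)
    have mI: "m \<in> I" using insert.prems lead_subset by blast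
    have "a ` T \<subseteq> low m"
    proof
      fix y assume "y \<in> a ` T"
      then obtain i where i: "i \<in> T" "y = a i" by blast
      then have im: "i < m" "i \<in> I" "a i - e i \<in> low i"
        using insert a lead_subset by blast+
      have "e i \<in> low m" using im unfolding low_def by (auto intro!: span_base)
      moreover have "a i - e i \<in> low m"
        using im(3) span_mono[of "e ` {j\<in>I. j < i}" "e ` {j\<in>I. j < m}"] im(1)
        unfolding low_def by fastforce
      ultimately have "(a i - e i) + e i \<in> low m" unfolding low_def by (rule span_add[rotated])
      then show "y \<in> low m" using i by simp
    qed
    then have "span (a ` T) \<subseteq> low m"
      unfolding low_def by (rule span_minimal) simp
    moreover have "a m \<notin> low m"
    proof
      assume "a m \<in> low m"
      moreover have "a m - e m \<in> low m"
        using a[of m] insert.prems by blast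
      ultimately have "a m - (a m - e m) \<in> low m"
        unfolding low_def by (rule span_diff)
      moreover have "e ` {j\<in>I. j < m} \<subseteq> e ` I - {e m}"
        using inj mI by (auto simp: inj_on_def)
      ultimately have "e m \<in> span (e ` I - {e m})"
        using span_mono[of "e ` {j\<in>I. j < m}" "e ` I - {e m}"] by (auto simp: low_def)
      then show False
        using indep mI unfolding dependent_def by blast
    qed
    ultimately have new: "a m \<notin> span (a ` T)" by blast
    then have "a m \<notin> a ` T" using span_base by blast
    moreover have "m \<notin> T" using insert.hyps(2) by blast
    moreover have "independent (a ` T) \<and> card (a ` T) = card T" using insert by simp
    ultimately show ?case
      using independent_insertI[OF new] insert.hyps(1) by simp
  qed (simp add: independent_empty)
  have le: "card T \<le> dim L" if "finite T" "T \<subseteq> lead L" for T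
  proof -
    have "a ` T \<subseteq> L" using that a by blast
    then show ?thesis
      using card_independent_le_dim_fd[OF L, of "a ` T"] indep_a[OF that] by auto
  qed
  have "finite (lead L)"
  proof (rule ccontr)
    assume "infinite (lead L)"
    then obtain T where "T \<subseteq> lead L" "finite T" "card T = Suc (dim L)"
      using infinite_arbitrarily_large by blast
    then show False using le[of T] by simp
  qed
  then show ?thesis using le by blast
qed

text \<open>This is Gaussian elimination. If some \<open>y \<in> L\<close> leads with the largest index \<open>m\<close>, then
  subtracting multiples of \<open>y\<close> moves every vector of \<open>L\<close> into the part of \<open>L\<close> that avoids \<open>m\<close>,
  and \<open>m\<close> accounts for \<open>y\<close>.\<close>

lemma spanning_set_card_le_lead:
  assumes "finite F" "F \<subseteq> I" "subspace L" "L \<subseteq> span (e ` F)"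
  shows "\<exists>T. finite T \<and> card T \<le> card (lead L \<inter> F) \<and> L \<subseteq> span T"
  using assms
proof (induction F arbitrary: L rule: finite_linorder_max_induct)
  case empty
  then show ?case by (intro exI[of _ "{}"]) auto
next
  case (insert m F)
  define L' where "L' = L \<inter> span (e ` F)"
  have L': "subspace L'" "L' \<subseteq> L" "L' \<subseteq> span (e ` F)"
    using insert.prems by (auto simp: L'_def intro: subspace_inter)
  obtain T where T: "finite T" "card T \<le> card (lead L' \<inter> F)" "L' \<subseteq> span T"
    using insert.IH[of L'] insert.prems L' by auto
  have TL: "card T \<le> card (lead L \<inter> F)"
    using T(2) card_mono[of "lead L \<inter> F" "lead L' \<inter> F"] lead_mono[OF L'(2)] insert.hyps(1)
    by (meson Int_mono finite_Int order_refl order_trans)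
  show ?case
  proof (cases "L = L'")
    case True
    have "card (lead L \<inter> F) \<le> card (lead L \<inter> insert m F)"
      using insert.hyps(1) by (intro card_mono) auto
    then show ?thesis using T TL True by (intro exI[of _ T]) auto
  next
    case False
    then obtain x where x: "x \<in> L" "x \<notin> span (e ` F)" by (auto simp: L'_def)
    obtain k where k: "x - k *s e m \<in> span (e ` F)"
      using x(1) insert.prems(3) span_breakdown_eq[of x "e m" "e ` F"] by auto
    have "k \<noteq> 0" using k x(2) by auto
    define y where "y = inverse k *s x"
    have y: "y \<in> L" "y - e m \<in> span (e ` F)"
    proof -
      show "y \<in> L" using x insert.prems(2) by (simp add: y_def subspace_scale)
      have "inverse k *s (x - k *s e m) \<in> span (e ` F)" using k by (rule span_scale)
      then show "y - e m \<in> span (e ` F)"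
        using \<open>k \<noteq> 0\<close> by (simp add: y_def scale_right_diff_distrib)
    qed
    have "e ` F \<subseteq> e ` {j\<in>I. j < m}" using insert by auto
    then have m: "m \<in> lead L"
      using y span_mono insert.prems(1) unfolding lead_def by blast
    have "L \<subseteq> span (insert y T)"
    proof
      fix z assume z: "z \<in> L"
      obtain c where c: "z - c *s e m \<in> span (e ` F)"
        using z insert.prems(3) span_breakdown_eq[of z "e m" "e ` F"] by auto
      have "z - c *s y = (z - c *s e m) - c *s (y - e m)"
        by (simp add: scale_right_diff_distrib)
      then have "z - c *s y \<in> span (e ` F)"
        by (simp only:) (intro span_diff span_scale c y(2))
      moreover have "z - c *s y \<in> L"
        using z y(1) insert.prems(2) by (simp add: subspace_diff subspace_scale)
      ultimately have "z - c *s y \<in> span T" using T(3) by (auto simp: L'_def)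
      then show "z \<in> span (insert y T)" using span_breakdown_eq by blast
    qed
    moreover have "card (insert y T) \<le> card (lead L \<inter> insert m F)"
    proof -
      have "m \<notin> F" using insert.hyps(2) by blast
      moreover have "lead L \<inter> insert m F = insert m (lead L \<inter> F)" using m by blast
      ultimately have "card (lead L \<inter> insert m F) = Suc (card (lead L \<inter> F))"
        using insert.hyps(1) by simp
      then show ?thesis using TL by (metis Suc_le_mono card_insert_le card_insert_if T(1) le_SucI)
    qed
    ultimately show ?thesis using T(1) by (intro exI[of _ "insert y T"]) auto
  qed
qed

lemma fd_subspace_in_finite_span:
  assumes L: "fd_subspace L" and I: "L \<subseteq> span (e ` I)"
  obtains F where "finite F" "F \<subseteq> I" "L \<subseteq> span (e ` F)"
proof -
  obtain B where B: "finite B" "L = span B"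
    using L by (auto simp: fd_subspace_def)
  have "\<exists>G. finite G \<and> G \<subseteq> e ` I \<and> b \<in> span G" if "b \<in> B" for b
  proof -
    have "b \<in> span (e ` I)" using that I B(2) span_base by blast
    then show ?thesis by (auto simp: span_explicit)
  qed
  then obtain G where G: "\<And>b. b \<in> B \<Longrightarrow> finite (G b) \<and> G b \<subseteq> e ` I \<and> b \<in> span (G b)"
    by metis
  have "b \<in> span (\<Union>(G ` B))" if "b \<in> B" for b
    using G[OF that] that span_mono[of "G b" "\<Union>(G ` B)"] by blast
  then have "L \<subseteq> span (\<Union>(G ` B))" using B(2) by (simp add: span_minimal subsetI)
  moreover have "finite (\<Union>(G ` B))" "\<Union>(G ` B) \<subseteq> e ` I" using G B(1) by auto
  ultimately show thesis using that by (metis finite_subset_image)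
qed

lemma card_lead_eq_dim:
  assumes L: "fd_subspace L" and I: "L \<subseteq> span (e ` I)"
  shows "finite (lead L)" "card (lead L) = dim L"
proof -
  have lead: "finite (lead L)" "card (lead L) \<le> dim L"
    using card_lead_le_dim[OF L] by auto
  obtain F where F: "finite F" "F \<subseteq> I" "L \<subseteq> span (e ` F)"
    using fd_subspace_in_finite_span[OF L I] by metis
  then obtain T where "finite T" "card T \<le> card (lead L \<inter> F)" "L \<subseteq> span T"
    using spanning_set_card_le_lead[OF F(1,2), of L] L by (auto simp: fd_subspace_def)
  then have "dim L \<le> card (lead L \<inter> F)" using dim_le_card[of L T] by linarith
  also have "\<dots> \<le> card (lead L)" using lead(1) by (intro card_mono) auto
  finally show "finite (lead L)" "card (lead L) = dim L" using lead by auto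
qed

end

section \<open>The order of words\<close>

text \<open>Words are compared lexicographically starting from the last letter. A common suffix is then
  read first and does not affect the comparison, so right multiplication is strictly monotone
  without any comparison of lengths.\<close>

instantiation free_word :: (countable) linorder
begin

definition reversed_code :: "'a free_word \<Rightarrow> nat list" where
  "reversed_code w = rev (map to_nat (letters w))"

definition "u \<le> v \<longleftrightarrow> reversed_code u \<le> reversed_code v"
definition "u < v \<longleftrightarrow> reversed_code u < reversed_code v"

instance
proof
  fix u v :: "'a free_word"
  assume "u \<le> v" "v \<le> u"
  then have "map to_nat (letters u) = map to_nat (letters v)"
    by (simp add: less_eq_free_word_def reversed_code_def)
  then have "letters u = letters v"
    by (simp add: inj_map_eq_map)
  then show "u = v" by (rule free_word.expand)
qed (auto simp: less_eq_free_word_def less_free_word_def)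

end

lemma word_less_append:
  fixes u v :: "'x::countable free_word"
  assumes "u < v"
  shows "u + w < v + w"
  using assms
  by (simp add: less_free_word_def reversed_code_def plus_free_word_def list_less_def
      lexord_append_leftI)

section \<open>Product spaces\<close>

context algebra_over
begin

lemma subspace_vimage_mult_right: "subspace P \<Longrightarrow> subspace {x. x * b \<in> P}"
  by (auto simp: subspace_def algebra_simps scale_mult_left)

lemma subspace_vimage_mult_left: "subspace P \<Longrightarrow> subspace {x. b * x \<in> P}"
  by (auto simp: subspace_def algebra_simps scale_mult_right)

lemma prod_space_span:
  "regular.prod_space (span S) (span T) = span {s * t | s t. s \<in> S \<and> t \<in> T}" (is "_ = span ?P")
proof
  have left: "s * v \<in> span ?P" if "s \<in> S" "v \<in> span T" for s v
  proof -
    have "span T \<subseteq> {x. s * x \<in> span ?P}"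
      using that(1) by (intro span_minimal subspace_vimage_mult_left) (auto intro: span_base)
    then show ?thesis using that(2) by blast
  qed
  have "l * v \<in> span ?P" if "l \<in> span S" "v \<in> span T" for l v
  proof -
    have "span S \<subseteq> {x. x * v \<in> span ?P}"
      using that(2) left by (intro span_minimal subspace_vimage_mult_right) auto
    then show ?thesis using that(1) by blast
  qed
  then show "regular.prod_space (span S) (span T) \<subseteq> span ?P"
    unfolding regular.prod_space_def by (intro span_minimal) auto
  show "span ?P \<subseteq> regular.prod_space (span S) (span T)"
    unfolding regular.prod_space_def by (intro span_mono) (auto intro: span_base)
qed

lemma prod_space_mono: "L \<subseteq> L' \<Longrightarrow> V \<subseteq> V' \<Longrightarrow> regular.prod_space L V \<subseteq> regular.prod_space L' V'"
  unfolding regular.prod_space_def by (intro span_mono) blast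

lemma mult_mem_prod_space: "l \<in> L \<Longrightarrow> v \<in> V \<Longrightarrow> l * v \<in> regular.prod_space L V"
  unfolding regular.prod_space_def by (blast intro: span_base)

lemma fd_subspace_prod_space:
  assumes "fd_subspace L" "fd_subspace V"
  shows "fd_subspace (regular.prod_space L V)"
proof -
  obtain S T where ST: "finite S" "L = span S" "finite T" "V = span T"
    using assms by (auto simp: fd_subspace_def)
  have "finite {s * t | s t. s \<in> S \<and> t \<in> T}"
    using ST by (simp add: finite_image_set2)
  then show ?thesis unfolding ST(2,4) prod_space_span by (rule fd_subspace_spanI)
qed

lemma dim_prod_space_insert_le:
  assumes S: "finite S" and V: "fd_subspace V"
  shows "dim (regular.prod_space (span (insert x S)) V) \<le> dim (regular.prod_space (span S) V) + dim V"
proof -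
  obtain B where B: "finite B" "span B = V" "card B = dim V"
    by (rule fd_subspace_basis[OF V])
  obtain C where C: "finite C" "span C = regular.prod_space (span S) V"
      "card C = dim (regular.prod_space (span S) V)"
    using fd_subspace_basis[OF fd_subspace_prod_space[OF fd_subspace_spanI[OF S] V]] by metis
  have "{s * b | s b. s \<in> insert x S \<and> b \<in> B} \<subseteq> span (C \<union> (*) x ` B)"
  proof clarify
    fix s b assume s: "s \<in> insert x S" and b: "b \<in> B"
    show "s * b \<in> span (C \<union> (*) x ` B)"
    proof (cases "s = x")
      case True
      then show ?thesis using b by (auto intro: span_base)
    next
      case False
      then have "s * b \<in> span C"
        unfolding C(2) using s b B(2) by (intro mult_mem_prod_space) (auto intro: span_base)
      then show ?thesis using span_mono[of C "C \<union> (*) x ` B"] by blast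
    qed
  qed
  then have "regular.prod_space (span (insert x S)) V \<subseteq> span (C \<union> (*) x ` B)"
    unfolding B(2)[symmetric] prod_space_span by (rule span_minimal) simp
  then have "dim (regular.prod_space (span (insert x S)) V) \<le> card (C \<union> (*) x ` B)"
    using B C by (intro dim_le_card) auto
  also have "\<dots> \<le> card C + card B"
    using card_Un_le[of C "(*) x ` B"] card_image_le[OF B(1), of "(*) x"] by linarith
  finally show ?thesis using B C by simp
qed

text \<open>\<open>A V\<close> is a left ideal, so \<open>K 1 + A V\<close> is closed under multiplication; being a subalgebra
  that contains \<open>V\<close>, it is everything. In particular \<open>A V\<close> has codimension at most 1 in \<open>A\<close>.\<close>

lemma generating_subspace_right_multiples:
  assumes "generating_subspace V"
  shows "span (insert 1 (regular.prod_space UNIV V)) = UNIV"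
proof -
  define P where "P = regular.prod_space UNIV V"
  define C where "C = span (insert 1 P)"
  have P_left: "a * p \<in> P" if "p \<in> P" for a p
  proof -
    have "P \<subseteq> {x. a * x \<in> P}"
      unfolding P_def regular.prod_space_def
      by (intro span_minimal subspace_vimage_mult_left)
        (use mult_mem_prod_space[of _ UNIV _ V] in
          \<open>auto simp: mult.assoc[symmetric] regular.prod_space_def\<close>)
    then show ?thesis using that by blast
  qed
  have "subalgebra C"
    unfolding subalgebra_def
  proof (intro conjI ballI)
    show "subspace C" "1 \<in> C" by (auto simp: C_def intro: span_base)
    fix a b assume a: "a \<in> C" and "b \<in> C"
    have "a * p \<in> C" if "p \<in> P" for p
      unfolding C_def using P_left[OF that] by (blast intro: span_base)
    then have "insert 1 P \<subseteq> {x. a * x \<in> C}" using a by auto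
    then have "C \<subseteq> {x. a * x \<in> C}"
      unfolding C_def by (intro span_minimal subspace_vimage_mult_left) auto
    then show "a * b \<in> C" using \<open>b \<in> C\<close> by blast
  qed
  moreover have "V \<subseteq> C"
    using mult_mem_prod_space[of 1 UNIV _ V] by (auto simp: C_def P_def intro!: span_base)
  ultimately have "subalgebra hull V \<subseteq> C" by (intro hull_minimal)
  then show ?thesis using assms by (auto simp: generating_subspace_def C_def P_def)
qed

end

section \<open>Monomials form a basis\<close>

context monomial_algebra
begin

abbreviation monomial :: "'x free_word \<Rightarrow> 'a" where
  "monomial w \<equiv> \<pi> (word_monom w)"

abbreviation nonzero_words :: "'x free_word set" where
  "nonzero_words \<equiv> {w. monomial w \<noteq> 0}"

lemma \<pi>_zero: "\<pi> 0 = 0"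
  using \<pi>_add[of 0 0] by simp

lemma \<pi>_sum: "\<pi> (sum f A) = (\<Sum>a\<in>A. \<pi> (f a))"
  by (induction A rule: infinite_finite_induct) (simp_all add: \<pi>_zero \<pi>_add)

lemma \<pi>_single: "\<pi> (Poly_Mapping.single w c) = scale c (monomial w)"
  using \<pi>_scale[of c "word_monom w"] by (simp add: word_monom_def mult_single)

lemma \<pi>_diff: "\<pi> (f - g) = \<pi> f - \<pi> g"
  using \<pi>_add[of "f - g" g] by simp

lemma monomial_add: "monomial (u + v) = monomial u * monomial v"
  by (simp add: \<pi>_mult[symmetric] word_monom_def mult_single)

text \<open>The kernel is spanned by words. Since \<open>monomial\<close> is multiplicative, the elements all of whose
  words map to zero form a two-sided ideal; it contains the generators of the kernel, hence all
  of it.\<close>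

lemma keys_of_kernel:
  assumes "\<pi> f = 0" "w \<in> Poly_Mapping.keys f"
  shows "monomial w = 0"
proof -
  define J where "J = {f :: 'x free_word \<Rightarrow>\<^sub>0 'k. \<forall>w\<in>Poly_Mapping.keys f. monomial w = 0}"
  obtain R where R: "{f. \<pi> f = 0} = two_sided_ideal hull (word_monom ` R)"
    using \<pi>_kernel by blast
  have "word_monom ` R \<subseteq> {f. \<pi> f = 0}" unfolding R by (rule hull_subset)
  then have "word_monom ` R \<subseteq> J" by (auto simp: J_def word_monom_def)
  moreover have "two_sided_ideal J"
    unfolding two_sided_ideal_def
  proof (intro conjI ballI allI)
    show "0 \<in> J" by (simp add: J_def)
    show "a + b \<in> J" if "a \<in> J" "b \<in> J" for a b
      using that keys_add[of a b] by (auto simp: J_def)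
    fix a r assume a: "a \<in> J"
    show "r * a \<in> J" "a * r \<in> J"
      using a keys_mult[of r a] keys_mult[of a r] by (fastforce simp: J_def monomial_add)+
  qed
  ultimately have "{f. \<pi> f = 0} \<subseteq> J" unfolding R by (rule hull_minimal)
  then show ?thesis using assms by (auto simp: J_def)
qed

lemma monomial_inj: "inj_on monomial nonzero_words"
proof (rule inj_onI, rule ccontr)
  fix u v assume uv: "u \<in> nonzero_words" "v \<in> nonzero_words" "monomial u = monomial v" "u \<noteq> v"
  let ?f = "word_monom u - word_monom v :: 'x free_word \<Rightarrow>\<^sub>0 'k"
  have "\<pi> ?f = 0" using uv(3) by (simp add: \<pi>_diff)
  moreover have "u \<in> Poly_Mapping.keys ?f"
    using uv(4) by (simp add: in_keys_iff lookup_minus word_monom_def lookup_single)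
  ultimately show False using keys_of_kernel uv(1) by blast
qed

lemma monomial_independent: "independent (monomial ` nonzero_words)"
proof
  assume "dependent (monomial ` nonzero_words)"
  then obtain T u v where T: "finite T" "T \<subseteq> monomial ` nonzero_words" "(\<Sum>a\<in>T. scale (u a) a) = 0"
    and v: "v \<in> T" "u v \<noteq> 0"
    unfolding dependent_explicit by blast
  obtain F where F: "finite F" "F \<subseteq> nonzero_words" "T = monomial ` F"
    using finite_subset_image[OF T(1,2)] by blast
  have inj: "inj_on monomial F" using monomial_inj F(2) by (rule inj_on_subset)
  define f where "f = (\<Sum>w\<in>F. Poly_Mapping.single w (u (monomial w)))"
  have "\<pi> f = (\<Sum>w\<in>F. scale (u (monomial w)) (monomial w))"
    by (simp add: f_def \<pi>_sum \<pi>_single)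
  also have "\<dots> = 0" using T(3) F(3) inj by (simp add: sum.reindex)
  finally have "\<pi> f = 0" .
  obtain w where w: "w \<in> F" "v = monomial w" using v(1) F(3) by blast
  have "Poly_Mapping.lookup f w = u (monomial w)"
    using F(1) w(1) by (simp add: f_def lookup_sum lookup_single when_def)
  then have "w \<in> Poly_Mapping.keys f" using v(2) w(2) by (simp add: in_keys_iff)
  then show False using keys_of_kernel[OF \<open>\<pi> f = 0\<close>] F(2) w(1) by blast
qed

lemma monomial_spanning: "span (monomial ` nonzero_words) = UNIV"
proof -
  have "\<pi> f \<in> span (monomial ` nonzero_words)" for f
  proof -
    have "f = (\<Sum>w\<in>Poly_Mapping.keys f. Poly_Mapping.single w (Poly_Mapping.lookup f w))"
      by (rule poly_mapping_eqI)
        (auto simp: lookup_sum lookup_single when_def in_keys_iff)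
    then have "\<pi> f = (\<Sum>w\<in>Poly_Mapping.keys f. scale (Poly_Mapping.lookup f w) (monomial w))"
      by (metis (no_types, lifting) \<pi>_single \<pi>_sum sum.cong)
    moreover have "monomial w \<in> span (monomial ` nonzero_words)" for w
      by (cases "monomial w = 0") (auto intro: span_base span_zero)
    ultimately show ?thesis by (simp add: span_sum span_scale)
  qed
  then have "range \<pi> \<subseteq> span (monomial ` nonzero_words)" by blast
  then show ?thesis using \<pi>_surj by auto
qed

sublocale words: ordered_independent_family scale monomial nonzero_words
  by unfold_locales (use monomial_independent monomial_inj in auto)

lemma fd_subspace_in_monomial_span:
  assumes "fd_subspace V"
  obtains S where "finite S" "S \<subseteq> nonzero_words" "V \<subseteq> span (monomial ` S)"
proof (rule words.fd_subspace_in_finite_span[OF assms])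
  show "V \<subseteq> span (monomial ` nonzero_words)" by (simp add: monomial_spanning)
qed (rule that)

lemma dim_monomial_span:
  assumes "S \<subseteq> nonzero_words"
  shows "dim (span (monomial ` S)) = card S"
proof -
  have "independent (monomial ` S)"
    by (rule independent_mono[OF monomial_independent image_mono[OF assms]])
  then have "dim (span (monomial ` S)) = card (monomial ` S)" by (rule dim_span_eq_card_independent)
  also have "\<dots> = card S" using inj_on_subset[OF monomial_inj assms] by (rule card_image)
  finally show ?thesis .
qed

lemma spanned_by_monomials_span: "spanned_by_monomials (span (monomial ` S))"
  unfolding spanned_by_monomials_def monomials_def by (intro exI[of _ "monomial ` S"]) auto

section \<open>Passing to leading monomials\<close>

lemma card_lead_eq_dim:
  assumes "fd_subspace L"
  shows "finite (words.lead L)" "card (words.lead L) = dim L"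
  using words.card_lead_eq_dim[OF assms] by (simp_all add: monomial_spanning)

text \<open>If \<open>a \<in> L\<close> has leading word \<open>t\<close> and \<open>t + s\<close> is nonzero in \<open>A\<close>, then \<open>a\<close> times \<open>s\<close> has leading word
  \<open>t + s\<close>: all lower words of \<open>a\<close> stay lower after appending \<open>s\<close>, or vanish.\<close>

lemma prod_space_lead_subset:
  "regular.prod_space (span (monomial ` words.lead L)) (span (monomial ` S))
     \<subseteq> span (monomial ` words.lead (regular.prod_space L (span (monomial ` S))))" (is "_ \<subseteq> ?R")
proof -
  let ?LV = "regular.prod_space L (span (monomial ` S))"
  have "monomial t * monomial s \<in> ?R" if t: "t \<in> words.lead L" and s: "s \<in> S" for t s
  proof (cases "monomial (t + s) = 0")
    case True
    then show ?thesis by (simp add: monomial_add span_zero)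
  next
    case False
    define low where "low w = span (monomial ` {j \<in> nonzero_words. j < w})" for w
    obtain a where a: "a \<in> L" "a - monomial t \<in> low t"
      using t by (auto simp: words.lead_def low_def)
    have "monomial ` {j \<in> nonzero_words. j < t} \<subseteq> {x. x * monomial s \<in> low (t + s)}"
    proof clarify
      fix j :: "'x free_word" assume "j < t"
      then have "j + s < t + s" by (rule word_less_append)
      then show "monomial j * monomial s \<in> low (t + s)"
        unfolding monomial_add[symmetric] low_def
        by (cases "monomial (j + s) = 0") (auto intro: span_base span_zero)
    qed
    then have "low t \<subseteq> {x. x * monomial s \<in> low (t + s)}"
      unfolding low_def by (intro span_minimal subspace_vimage_mult_right) auto
    then have "a * monomial s - monomial (t + s) \<in> low (t + s)"
      using a(2) by (auto simp: monomial_add algebra_simps)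
    moreover have "a * monomial s \<in> ?LV"
      using a(1) s by (intro mult_mem_prod_space) (auto intro: span_base)
    ultimately have "t + s \<in> words.lead ?LV"
      using False by (auto simp: words.lead_def low_def)
    then show ?thesis by (simp add: monomial_add[symmetric] span_base)
  qed
  then show ?thesis
    unfolding prod_space_span by (intro span_minimal) auto
qed

lemma invariant_subspace_antimono:
  assumes "regular.invariant_subspace V' \<epsilon> L" "V \<subseteq> V'" "fd_subspace V'"
  shows "regular.invariant_subspace V \<epsilon> L"
proof -
  have "dim (regular.prod_space L V) \<le> dim (regular.prod_space L V')"
    using assms by (intro dim_mono_fd fd_subspace_prod_space prod_space_mono)
      (auto simp: regular.invariant_subspace_def)
  then show ?thesis using assms(1) by (auto simp: regular.invariant_subspace_def)
qed

lemma invariant_subspace_lead: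
  assumes "finite S" and L: "regular.invariant_subspace (span (monomial ` S)) \<epsilon> L"
  shows "regular.invariant_subspace (span (monomial ` S)) \<epsilon> (span (monomial ` words.lead L))"
proof -
  let ?V = "span (monomial ` S)"
  have fd: "fd_subspace L" using L by (simp add: regular.invariant_subspace_def)
  have LV: "fd_subspace (regular.prod_space L ?V)"
    using fd assms(1) by (intro fd_subspace_prod_space fd_subspace_spanI) auto
  have "dim (regular.prod_space (span (monomial ` words.lead L)) ?V)
      \<le> dim (span (monomial ` words.lead (regular.prod_space L ?V)))"
    using prod_space_lead_subset card_lead_eq_dim(1)[OF LV]
    by (intro dim_mono_fd fd_subspace_spanI) auto
  also have "\<dots> = dim (regular.prod_space L ?V)"
    using dim_monomial_span[OF words.lead_subset] card_lead_eq_dim(2)[OF LV] by simp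
  finally show ?thesis
    using L card_lead_eq_dim[OF fd] dim_monomial_span[OF words.lead_subset, of L]
    by (auto simp: regular.invariant_subspace_def intro: fd_subspace_spanI)
qed

lemma monomial_invariant_subspace_exists:
  assumes "regular.amenable" "fd_subspace V" "\<epsilon> > 0"
  shows "\<exists>L. regular.invariant_subspace V \<epsilon> L \<and> spanned_by_monomials L"
proof -
  obtain S where S: "finite S" "V \<subseteq> span (monomial ` S)"
    by (rule fd_subspace_in_monomial_span[OF assms(2)])
  have V': "fd_subspace (span (monomial ` S))" using S(1) by (intro fd_subspace_spanI) auto
  obtain L where "regular.invariant_subspace (span (monomial ` S)) \<epsilon> L"
    using assms V' by (auto simp: regular.amenable_def)
  then show ?thesis
    using invariant_subspace_lead[OF S(1)] invariant_subspace_antimono[OF _ S(2) V']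
      spanned_by_monomials_span by blast
qed

lemma monomial_invariant_subspace_exhausting:
  assumes "regular.exhaustively_amenable" "fd_subspace V" "\<epsilon> > 0"
    and W: "finite W" "W \<subseteq> nonzero_words"
  obtains T where "finite T" "W \<subseteq> T" "T \<subseteq> nonzero_words"
    "regular.invariant_subspace V \<epsilon> (span (monomial ` T))"
proof -
  obtain S where S: "finite S" "V \<subseteq> span (monomial ` S)"
    by (rule fd_subspace_in_monomial_span[OF assms(2)])
  have V': "fd_subspace (span (monomial ` S))" using S(1) by (intro fd_subspace_spanI) auto
  have "fd_subspace (span (monomial ` W))" using W(1) by (intro fd_subspace_spanI) auto
  then obtain L where L: "regular.invariant_subspace (span (monomial ` S)) \<epsilon> L" "span (monomial ` W) \<subseteq> L"
    using assms(1,3) V' unfolding regular.exhaustively_amenable_def by blast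
  show thesis
  proof (rule that)
    show "finite (words.lead L)"
      using L card_lead_eq_dim by (auto simp: regular.invariant_subspace_def)
    show "W \<subseteq> words.lead L"
    proof
      fix w assume w: "w \<in> W"
      have "monomial w \<in> span (monomial ` W)" using w by (intro span_base imageI)
      then show "w \<in> words.lead L" using w W(2) L(2) by (intro words.mem_leadI) auto
    qed
    show "regular.invariant_subspace V \<epsilon> (span (monomial ` words.lead L))"
      using invariant_subspace_lead[OF S(1) L(1)] invariant_subspace_antimono[OF _ S(2) V'] by blast
  qed (rule words.lead_subset)
qed

section \<open>Correcting a deficient product space\<close>

abbreviation rank :: "'a set \<Rightarrow> 'x free_word set \<Rightarrow> nat" where
  "rank V S \<equiv> dim (regular.prod_space (span (monomial ` S)) V)"

text \<open>If no word enlarged the product space, it would contain \<open>A V\<close>, and then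
  \<open>A = K 1 + A V\<close> would be finite-dimensional.\<close>

lemma rank_increasing_word:
  assumes V: "generating_subspace V" and inf: "\<not> fd_subspace (UNIV :: 'a set)" and S: "finite S"
  obtains w where "w \<in> nonzero_words" "rank V S < rank V (insert w S)"
proof -
  let ?P = "regular.prod_space (span (monomial ` S)) V"
  have fdV: "fd_subspace V" using V by (simp add: generating_subspace_def)
  have fd: "fd_subspace (regular.prod_space (span (monomial ` T)) V)" if "finite T" for T
    using that fdV by (intro fd_subspace_prod_space fd_subspace_spanI) auto
  have "\<exists>w\<in>nonzero_words. \<exists>v\<in>V. monomial w * v \<notin> ?P"
  proof (rule ccontr)
    assume "\<not> ?thesis"
    then have "monomial ` nonzero_words \<subseteq> {x. x * v \<in> ?P}" if "v \<in> V" for v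
      using that by blast
    then have "span (monomial ` nonzero_words) \<subseteq> {x. x * v \<in> ?P}" if "v \<in> V" for v
      using that by (intro span_minimal subspace_vimage_mult_right) (auto simp: regular.prod_space_def)
    then have "regular.prod_space UNIV V \<subseteq> ?P"
      unfolding monomial_spanning regular.prod_space_def[of UNIV]
      by (intro span_minimal) (auto simp: regular.prod_space_def)
    moreover obtain B where B: "finite B" "span B = ?P"
      using fd_subspace_basis[OF fd[OF S]] by metis
    ultimately have "insert 1 (regular.prod_space UNIV V) \<subseteq> span (insert 1 B)"
      using span_mono[of B "insert 1 B"] by (auto intro: span_base)
    then have "span (insert 1 B) = UNIV"
      using generating_subspace_right_multiples[OF V]
      by (metis span_minimal subspace_span top.extremum_uniqueI)
    then show False using inf B(1) fd_subspace_spanI by (metis finite_insert)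
  qed
  then obtain w v where w: "w \<in> nonzero_words" "v \<in> V" "monomial w * v \<notin> ?P" by blast
  have "rank V S < rank V (insert w S)"
  proof (rule dim_strict_mono_fd)
    show "monomial w * v \<in> regular.prod_space (span (monomial ` insert w S)) V"
      using w(2) by (intro mult_mem_prod_space) (auto intro: span_base)
    show "?P \<subseteq> regular.prod_space (span (monomial ` insert w S)) V"
      by (intro prod_space_mono span_mono) auto
  qed (use w(3) S in \<open>auto simp del: image_insert intro: fd\<close>)
  then show thesis using that w(1) by blast
qed

text \<open>Words that increase the rank are added until the lower bound holds. Just before such an
  addition the rank is below \<open>(1 - \<epsilon>) card T\<close>, and it grows by at most \<open>dim V \<le> \<epsilon> card S\<close>, so the upper
  bound is never lost.\<close>

lemma nearly_balanced_superset:
  assumes V: "generating_subspace V" and inf: "\<not> fd_subspace (UNIV :: 'a set)" and "\<epsilon> > 0"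
    and S: "finite S" "S \<subseteq> nonzero_words"
    and upper: "real (rank V S) \<le> (1 + \<epsilon>) * real (card S)"
    and large: "real (dim V) \<le> \<epsilon> * real (card S)"
  obtains T where "finite T" "S \<subseteq> T" "T \<subseteq> nonzero_words"
    "(1 - \<epsilon>) * real (card T) \<le> real (rank V T)" "real (rank V T) \<le> (1 + \<epsilon>) * real (card T)"
proof -
  define good where "good T \<longleftrightarrow> finite T \<and> S \<subseteq> T \<and> T \<subseteq> nonzero_words \<and>
    real (rank V T) \<le> (1 + \<epsilon>) * real (card T)" for T
  have fdV: "fd_subspace V" using V by (simp add: generating_subspace_def)
  \<comment> \<open>After \<open>n\<close> additions, either the lower bound has been reached or the rank is at least \<open>n\<close>.\<close>
  have step: "\<exists>T. good T \<and> ((1 - \<epsilon>) * real (card T) \<le> real (rank V T) \<or>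
      card T \<le> card S + n \<and> n \<le> rank V T)" for n
  proof (induction n)
    case 0
    then show ?case using S upper by (intro exI[of _ S]) (auto simp: good_def)
  next
    case (Suc n)
    then obtain T where T: "good T" and alt: "(1 - \<epsilon>) * real (card T) \<le> real (rank V T) \<or>
      card T \<le> card S + n \<and> n \<le> rank V T" by blast
    show ?case
    proof (cases "(1 - \<epsilon>) * real (card T) \<le> real (rank V T)")
      case True
      then show ?thesis using T by blast
    next
      case False
      have finT: "finite T" using T by (simp add: good_def)
      obtain w where w: "w \<in> nonzero_words" "rank V T < rank V (insert w T)"
        using rank_increasing_word[OF V inf finT] by blast
      then have wT: "w \<notin> T" by (metis insert_absorb nat_neq_iff)
      have "card S \<le> card T" using T by (auto simp: good_def intro: card_mono)
      then have "real (dim V) \<le> \<epsilon> * real (card T)"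
        using large \<open>\<epsilon> > 0\<close> by (meson mult_left_mono less_imp_le of_nat_mono order_trans)
      moreover have "rank V (insert w T) \<le> rank V T + dim V"
        using dim_prod_space_insert_le[of "monomial ` T" V "monomial w"] finT fdV by simp
      ultimately have "real (rank V (insert w T)) \<le> (1 - \<epsilon>) * real (card T) + \<epsilon> * real (card T)"
        using False by linarith
      also have "\<dots> \<le> (1 + \<epsilon>) * real (card (insert w T))"
        using finT wT \<open>\<epsilon> > 0\<close> by (simp add: algebra_simps)
      finally have "good (insert w T)" using T w(1) by (auto simp: good_def)
      moreover have "card (insert w T) \<le> card S + Suc n \<and> Suc n \<le> rank V (insert w T)"
        using False alt finT wT w(2) by auto
      ultimately show ?thesis by blast
    qed
  qed
  \<comment> \<open>For such \<open>n\<close> the second alternative implies the first: the deficit \<open>card T - rank V T\<close> is at most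
    \<open>card S \<le> \<epsilon> n\<close>, which suffices if \<open>n \<le> card T\<close>, and otherwise it is negative.\<close>
  obtain n :: nat where n: "real (card S) / \<epsilon> \<le> real n"
    using real_arch_simple by blast
  obtain T where T: "good T" and alt: "(1 - \<epsilon>) * real (card T) \<le> real (rank V T) \<or>
      card T \<le> card S + n \<and> n \<le> rank V T"
    using step[of n] by blast
  have "(1 - \<epsilon>) * real (card T) \<le> real (rank V T)"
    using alt
  proof
    assume c: "card T \<le> card S + n \<and> n \<le> rank V T"
    show ?thesis
    proof (cases "n \<le> card T")
      case True
      have "real (card S) \<le> \<epsilon> * real n"
        using n \<open>\<epsilon> > 0\<close> by (simp add: pos_divide_le_eq mult.commute)
      also have "\<dots> \<le> \<epsilon> * real (card T)" using True \<open>\<epsilon> > 0\<close> by simp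
      finally have "real (card S) \<le> \<epsilon> * real (card T)" .
      then show ?thesis using c by (simp add: algebra_simps)
    next
      case False
      then have "real (card T) \<le> real (rank V T)" using c by simp
      moreover have "0 \<le> \<epsilon> * real (card T)" using \<open>\<epsilon> > 0\<close> by simp
      ultimately show ?thesis by (simp add: algebra_simps)
    qed
  qed
  then show thesis using that[of T] T by (simp add: good_def)
qed

lemma monomial_span_ratio_near_one:
  assumes ex: "regular.exhaustively_amenable" and V: "generating_subspace V"
    and inf: "\<not> fd_subspace (UNIV :: 'a set)" and "\<epsilon> > 0"
    and W: "finite W" "W \<subseteq> nonzero_words"
  obtains T where "finite T" "W \<subseteq> T" "T \<subseteq> nonzero_words"
    "\<bar>real (rank V T) / real (card T) - 1\<bar> \<le> \<epsilon>"
proof -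
  have fdV: "fd_subspace V" using V by (simp add: generating_subspace_def)
  obtain n :: nat where n: "real (dim V) / \<epsilon> \<le> real n"
    using real_arch_simple by blast
  \<comment> \<open>Extra words \<open>N\<close> force the invariant subspace to be large compared with \<open>dim V\<close>.\<close>
  have "infinite nonzero_words"
    using inf monomial_spanning fd_subspace_spanI by (metis finite_imageI)
  then obtain N where N: "N \<subseteq> nonzero_words" "finite N" "card N = Suc n"
    using infinite_arbitrarily_large by blast
  obtain S where S: "finite S" "W \<union> N \<subseteq> S" "S \<subseteq> nonzero_words"
      "regular.invariant_subspace V \<epsilon> (span (monomial ` S))"
    using monomial_invariant_subspace_exhausting[OF ex fdV \<open>\<epsilon> > 0\<close>, of "W \<union> N"] W N by auto
  have "Suc n \<le> card S" using N S by (metis Un_subset_iff card_mono)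
  have "real (dim V) \<le> \<epsilon> * real n"
    using n \<open>\<epsilon> > 0\<close> by (simp add: pos_divide_le_eq mult.commute)
  also have "\<dots> \<le> \<epsilon> * real (card S)" using \<open>Suc n \<le> card S\<close> \<open>\<epsilon> > 0\<close> by simp
  finally have large: "real (dim V) \<le> \<epsilon> * real (card S)" .
  have upper: "real (rank V S) \<le> (1 + \<epsilon>) * real (card S)"
    using S(3,4) dim_monomial_span by (simp add: regular.invariant_subspace_def)
  obtain T where T: "finite T" "S \<subseteq> T" "T \<subseteq> nonzero_words"
    "(1 - \<epsilon>) * real (card T) \<le> real (rank V T)" "real (rank V T) \<le> (1 + \<epsilon>) * real (card T)"
    using nearly_balanced_superset[OF V inf \<open>\<epsilon> > 0\<close> S(1,3) upper large] by blast
  have "card T > 0"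
    using card_mono[OF T(1,2)] \<open>Suc n \<le> card S\<close> by linarith
  then have "\<bar>real (rank V T) / real (card T) - 1\<bar> \<le> \<epsilon>"
    using T(4,5) by (simp add: abs_le_iff field_simps)
  moreover have "W \<subseteq> T" using S(2) T(2) by blast
  ultimately show thesis using that T(1,3) by blast
qed

section \<open>Monomial Folner sequences\<close>

lemma finite_words_bounded_length: "finite {w :: 'x free_word. length (letters w) \<le> n}"
proof -
  have "{w :: 'x free_word. length (letters w) \<le> n} \<subseteq> Word ` {xs. set xs \<subseteq> UNIV \<and> length xs \<le> n}"
  proof
    fix w :: "'x free_word" assume "w \<in> {w. length (letters w) \<le> n}"
    then show "w \<in> Word ` {xs. set xs \<subseteq> UNIV \<and> length xs \<le> n}"
      by (intro image_eqI[of _ _ "letters w"]) auto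
  qed
  then show ?thesis
    by (rule finite_subset) (simp add: finite_lists_length_le[of UNIV n, simplified])
qed

lemma monomial_Folner_sequence_infinite_dim:
  assumes ex: "regular.exhaustively_amenable" and V: "generating_subspace V"
    and inf: "\<not> fd_subspace (UNIV :: 'a set)"
  shows "\<exists>L. Folner_sequence V L \<and> (\<forall>n. spanned_by_monomials (L n))"
proof -
  \<comment> \<open>The \<open>n\<close>-th term contains all nonzero monomials of length at most \<open>n\<close>, so the chain exhausts \<open>A\<close>.\<close>
  define ball where "ball n = {w \<in> nonzero_words. length (letters w) \<le> n}" for n
  have fin_ball: "finite (ball n)" for n
    unfolding ball_def using finite_words_bounded_length[of n] by (rule rev_finite_subset) auto
  define P where "P n T \<longleftrightarrow> finite T \<and> ball n \<subseteq> T \<and> T \<subseteq> nonzero_words \<and>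
    \<bar>real (rank V T) / real (card T) - 1\<bar> \<le> 1 / real (Suc n)" for n T
  have ext: "\<exists>T. P n T \<and> W \<subseteq> T" if "finite W" "W \<subseteq> nonzero_words" for n W
  proof -
    have "finite (W \<union> ball n)" "W \<union> ball n \<subseteq> nonzero_words"
      using that fin_ball by (auto simp: ball_def)
    then obtain T where "finite T" "W \<union> ball n \<subseteq> T" "T \<subseteq> nonzero_words"
        "\<bar>real (rank V T) / real (card T) - 1\<bar> \<le> 1 / real (Suc n)"
      using monomial_span_ratio_near_one[OF ex V inf, of "1 / real (Suc n)" "W \<union> ball n"]
      by (metis of_nat_0_less_iff zero_less_Suc zero_less_divide_1_iff)
    then show ?thesis unfolding P_def by blast
  qed
  obtain S where S: "\<And>n. P n (S n)" "\<And>n. S n \<subseteq> S (Suc n)"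
    using dependent_nat_choice[of P "\<lambda>_ T T'. T \<subseteq> T'"] ext[of "{}"] ext
    by (metis P_def empty_subsetI finite.emptyI)
  define L where "L n = span (monomial ` S n)" for n
  have "Folner_sequence V L"
    unfolding Folner_sequence_def
  proof (intro conjI allI)
    fix n
    show "fd_subspace (L n)" using S(1)[of n] by (auto simp: L_def P_def intro: fd_subspace_spanI)
    show "L n \<subseteq> L (Suc n)" using S(2) unfolding L_def by (intro span_mono image_mono)
  next
    have "\<exists>n. a \<in> L n" for a
    proof -
      have "fd_subspace (span {a})" by (intro fd_subspace_spanI) simp
      then obtain F where F: "finite F" "F \<subseteq> nonzero_words" "span {a} \<subseteq> span (monomial ` F)"
        by (rule fd_subspace_in_monomial_span)
      obtain n where "\<forall>w\<in>F. length (letters w) \<le> n"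
        using F(1) finite_nat_set_iff_bounded_le[of "(\<lambda>w. length (letters w)) ` F"] by auto
      then have "F \<subseteq> S n" using F(2) S(1)[of n] by (auto simp: P_def ball_def)
      then have "span (monomial ` F) \<subseteq> L n" unfolding L_def by (intro span_mono image_mono)
      moreover have "a \<in> span {a}" by (simp add: span_base)
      ultimately have "a \<in> L n" using F(3) by auto
      then show ?thesis ..
    qed
    then show "(\<Union>n. L n) = UNIV" by blast
  next
    have "(\<lambda>n. real (rank V (S n)) / real (card (S n)) - 1) \<longlonglongrightarrow> 0"
    proof (rule tendsto_rabs_zero_cancel, rule tendsto_sandwich[OF _ _ tendsto_const])
      show "(\<lambda>n. 1 / real (Suc n)) \<longlonglongrightarrow> 0" by (rule LIMSEQ_inverse_real_of_nat[unfolded inverse_eq_divide])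
    qed (use S(1) in \<open>auto simp: P_def\<close>)
    then have "(\<lambda>n. real (rank V (S n)) / real (card (S n))) \<longlonglongrightarrow> 1"
      by (simp add: LIM_zero_iff)
    moreover have "card (S n) = dim (L n)" for n
      using S(1)[of n] dim_monomial_span[of "S n"] by (simp add: L_def P_def)
    ultimately show "(\<lambda>n. real (dim (regular.prod_space (L n) V)) / real (dim (L n))) \<longlonglongrightarrow> 1"
      by (simp add: L_def)
  qed
  then show ?thesis using spanned_by_monomials_span unfolding L_def by blast
qed

lemma monomial_Folner_sequence_finite_dim:
  assumes fd: "fd_subspace (UNIV :: 'a set)" and "1 \<in> V"
  shows "Folner_sequence V (\<lambda>_. UNIV) \<and> spanned_by_monomials UNIV"
proof
  have "regular.prod_space UNIV V = UNIV"
    using mult_mem_prod_space[OF UNIV_I \<open>1 \<in> V\<close>] by auto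
  moreover have "dim (UNIV :: 'a set) > 0"
    using card_independent_le_dim_fd[OF fd, of "{1}"] by (simp add: dependent_single)
  ultimately show "Folner_sequence V (\<lambda>_. UNIV)"
    using fd by (simp add: Folner_sequence_def)
  show "spanned_by_monomials UNIV"
    using spanned_by_monomials_span[of nonzero_words] monomial_spanning by simp
qed

end

theorem corollary3p3:
  fixes scale :: "'k::field \<Rightarrow> 'a::ring_1 \<Rightarrow> 'a"
    and \<pi> :: "('x::finite free_word \<Rightarrow>\<^sub>0 'k) \<Rightarrow> 'a"
  assumes "monomial_algebra scale \<pi>"
    and "right_module.amenable scale scale (*)"
  shows "(\<forall>V \<epsilon>. vector_space.fd_subspace scale V \<longrightarrow> \<epsilon> > 0 \<longrightarrow>
            (\<exists>L. right_module.invariant_subspace scale (*) V \<epsilon> L \<and>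
                 monomial_algebra.spanned_by_monomials scale \<pi> L)) \<and>
         (right_module.exhaustively_amenable scale scale (*) \<longrightarrow>
            (\<forall>V. algebra_over.generating_subspace scale V \<longrightarrow>
                 1 \<in> V \<or> \<not> vector_space.fd_subspace scale (UNIV :: 'a set) \<longrightarrow>
              (\<exists>L. algebra_over.Folner_sequence scale V L \<and>
                   (\<forall>n. monomial_algebra.spanned_by_monomials scale \<pi> (L n)))))"
proof -
  interpret monomial_algebra scale \<pi> by (rule assms(1))
  show ?thesis
    using monomial_invariant_subspace_exists[OF assms(2)] monomial_Folner_sequence_infinite_dim
      monomial_Folner_sequence_finite_dim
    by blast
qed

end
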